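(* Let $A\in\mathbb{R}^{m\times n}$, $b\in\mathrm{range}(A)$ and $x_0\in\mathbb{R}^n$. Let $r_k:=b-Ax_k$, and let iterates be generated by $x_k=x_{k-1}+p_k$, $k=1,2,\dots$, with $$p_k=A^\top S_k\,(S_k^\top A A^\top S_k)^{-1}S_k^\top r_{k-1},\qquad S_k:=[\,r_0\;\; r_1\;\cdots\; r_{k-1}\,]\in\mathbb{R}^{m\times k},$$ and put $y_k:=A^\top r_{k-1}$. Then, for every $k\ge 2$ for which $S_k$ has full column rank, the update $p_k$ can be computed by the 1-step recursive formula $$p_k=\beta_{k-1}\,p_{k-1}+\gamma_{k-1}\,y_k,$$ where $$\beta_{k-1}:=\frac{1}{\left(\frac{\|p_{k-1}\|\,\|y_k\|}{\|r_{k-1}\|\,\|r_{k-1}\|}-1\right)\left(\frac{\|p_{k-1}\|\,\|y_k\|}{\|r_{k-1}\|\,\|r_{k-1}\|}+1\right)},$$ $$\gamma_{k-1}:=\frac{\|r_{k-1}\|^2}{\|y_k\|^2\left(1-\frac{\|r_{k-1}\|\,\|r_{k-1}\|}{\|p_{k-1}\|\,\|y_k\|}\right)\left(1+\frac{\|r_{k-1}\|\,\|r_{k-1}\|}{\|p_{k-1}\|\,\|y_k\|}\right)}.$$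
   Context: $\|\cdot\|$ is the Euclidean norm. Since $b\in\mathrm{range}(A)$, every residual $r_k$ lies in $\mathrm{range}(A)$, so the inverse defining $p_k$ exists whenever $S_k$ has full column rank. *)

theory Defs
  imports Complex_Main "Jordan_Normal_Form.Gauss_Jordan_Elimination" "Jordan_Normal_Form.DL_Rank"
begin

text \<open>The matrices $S_k$ have a number of columns that varies with $k$, so vectors and matrices are
  the carrier-based ones of the Jordan normal form library.\<close>

definition vnorm :: "real vec \<Rightarrow> real" where
  "vnorm v = sqrt (v \<bullet> v)"

text \<open>The library function returns \<open>None\<close> on a singular argument; in that case the
  value below is unspecified.\<close>

definition mat_inv :: "real mat \<Rightarrow> real mat" where
  "mat_inv M = the (mat_inverse M)"

definition residual_mat :: "nat \<Rightarrow> (nat \<Rightarrow> real vec) \<Rightarrow> nat \<Rightarrow> real mat" where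
  "residual_mat m r k = mat_of_cols m (map r [0..<k])"

definition full_column_rank :: "real mat \<Rightarrow> bool" where
  "full_column_rank M \<longleftrightarrow> vec_space.rank (dim_row M) M = dim_col M"

end

(* The defining equations of p_k say that r_k is orthogonal to r_0, ..., r_{k-1}. Hence p_k lies in
   span(y_1, ..., y_k) and is orthogonal to y_1, ..., y_{k-1}, so the p_j are orthogonal; and
   y_k . p_j = r_{k-1} . (r_{j-1} - r_j) vanishes for j < k-1. Expanding y_k in the orthogonal basis
   p_1, ..., p_k therefore leaves only two terms,
     y_k = (s / |p_k|^2) p_k - (s / |p_{k-1}|^2) p_{k-1},   s = |r_{k-1}|^2.
   Solving for p_k gives the coefficients |p_k|^2 / |p_{k-1}|^2 and |p_k|^2 / s, and the formulas for
   beta and gamma follow from |y_k|^2 = s^2 / |p_k|^2 + s^2 / |p_{k-1}|^2. *)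
theory Submission
  imports Defs
begin

section \<open>Norms, column rank and trivial kernels\<close>

lemma scalar_prod_self_eq_0:
  fixes v :: "real vec"
  assumes "v \<in> carrier_vec n"
  shows "v \<bullet> v = 0 \<longleftrightarrow> v = 0\<^sub>v n"
proof -
  have "v \<bullet> v = 0 \<longleftrightarrow> (\<forall>i<dim_vec v. v $ i = 0)"
    by (auto simp: scalar_prod_def sum_nonneg_eq_0_iff)
  also have "\<dots> \<longleftrightarrow> v = 0\<^sub>v n"
    using assms by (metis carrier_vecD eq_vecI index_zero_vec)
  finally show ?thesis .
qed

lemma vnorm_square: "vnorm v * vnorm v = v \<bullet> v"
  by (simp add: vnorm_def scalar_prod_def sum_nonneg)

lemma mat_mult_unit_vec:
  fixes M :: "'a :: semiring_1 mat"
  assumes "M \<in> carrier_mat m k" "i < k"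
  shows "M *\<^sub>v unit_vec k i = col M i"
  using assms by (intro eq_vecI) auto

text \<open>Rank is counted on the set of columns, which forgets repetitions. Both directions
  therefore first show that the columns are distinct; after that, linear dependence of the set is
  the same as a nonzero kernel vector.\<close>

lemma full_column_rank_iff_trivial_kernel:
  assumes M: "M \<in> carrier_mat m k"
  shows "full_column_rank M \<longleftrightarrow> (\<forall>v\<in>carrier_vec k. M *\<^sub>v v = 0\<^sub>v m \<longrightarrow> v = 0\<^sub>v k)"
proof -
  interpret vec_space "TYPE(real)" m .
  have len: "length (cols M) = k" using M by simp
  show ?thesis
  proof
    assume "full_column_rank M"
    then have rk: "rank M = k" using M by (simp add: full_column_rank_def)
    \<comment> \<open>A maximal independent set of columns has \<open>rank M = k\<close> elements,
      so a list of \<open>k\<close> columns has no room for a repetition.\<close>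
    obtain U where U: "maximal U (\<lambda>T. T \<subseteq> set (cols M) \<and> lin_indpt T)"
      using maximal_exists[of "\<lambda>T. T \<subseteq> set (cols M) \<and> lin_indpt T" "card (set (cols M))" "{}"]
      by (meson List.finite_set card_mono empty_iff empty_subsetI finite_lin_indpt2 rev_finite_subset)
    then have "card U = k" "U \<subseteq> set (cols M)"
      using rank_card_indpt[OF M U] rk by (auto simp: maximal_def)
    then have "k \<le> card (set (cols M))" by (metis List.finite_set card_mono)
    then have dist: "distinct (cols M)"
      using len card_length[of "cols M"] by (intro card_distinct) auto
    show "\<forall>v\<in>carrier_vec k. M *\<^sub>v v = 0\<^sub>v m \<longrightarrow> v = 0\<^sub>v k"
      using full_rank_lin_indpt[OF M rk dist] lin_depI[OF M _ _ _ dist] by blast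
  next
    assume ker: "\<forall>v\<in>carrier_vec k. M *\<^sub>v v = 0\<^sub>v m \<longrightarrow> v = 0\<^sub>v k"
    have dist: "distinct (cols M)"
      unfolding distinct_conv_nth
    proof (intro allI impI)
      fix i j assume i: "i < length (cols M)" and j: "j < length (cols M)" and ij: "i \<noteq> j"
      \<comment> \<open>Two equal columns would put this nonzero vector into the kernel.\<close>
      let ?v = "unit_vec k i - unit_vec k j :: real vec"
      have "M *\<^sub>v ?v = M *\<^sub>v unit_vec k i - M *\<^sub>v unit_vec k j"
        using M by (intro mult_minus_distrib_mat_vec) auto
      also have "\<dots> = col M i - col M j"
        using mat_mult_unit_vec[OF M] i j len by simp
      finally have Mv: "M *\<^sub>v ?v = col M i - col M j" .
      have "?v $ i \<noteq> 0" using i j ij len by simp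
      then have "?v \<noteq> 0\<^sub>v k" using i len by (metis index_zero_vec(1))
      then have "M *\<^sub>v ?v \<noteq> 0\<^sub>v m" using ker by auto
      then show "cols M ! i \<noteq> cols M ! j" using Mv i j M by auto
    qed
    have "lin_indpt (set (cols M))" using lin_depE[OF M _ dist] ker by metis
    then show "full_column_rank M"
      using lin_indpt_full_rank[OF M dist] M by (simp add: full_column_rank_def)
  qed
qed

text \<open>Leading columns of an independent family are independent. Full rank at \<open>k\<close>
  thus unlocks the rank-guarded equations for all earlier iterates: a kernel vector padded with
  zeros stays a kernel vector.\<close>

lemma full_column_rank_residual_mat_mono:
  assumes k: "full_column_rank (residual_mat m r k)" and "j \<le> k"
  shows "full_column_rank (residual_mat m r j)"
proof -
  have car: "residual_mat m r i \<in> carrier_mat m i" for i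
    by (simp add: residual_mat_def carrier_matI)
  show ?thesis
    unfolding full_column_rank_iff_trivial_kernel[OF car]
  proof (intro ballI impI)
    fix v :: "real vec" assume v: "v \<in> carrier_vec j" and 0: "residual_mat m r j *\<^sub>v v = 0\<^sub>v m"
    let ?u = "vec k (\<lambda>i. if i < j then v $ i else 0)"
    have "residual_mat m r k *\<^sub>v ?u = residual_mat m r j *\<^sub>v v"
    proof (rule eq_vecI)
      fix i assume "i < dim_vec (residual_mat m r j *\<^sub>v v)"
      then have i: "i < m" by (simp add: residual_mat_def)
      have "(residual_mat m r k *\<^sub>v ?u) $ i = (\<Sum>l<k. r l $ i * (if l < j then v $ l else 0))"
        using i by (simp add: residual_mat_def scalar_prod_def mat_of_cols_index atLeast0LessThan)
      also have "\<dots> = (\<Sum>l<j. r l $ i * v $ l)"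
        using \<open>j \<le> k\<close> by (intro sum.mono_neutral_cong_right) auto
      also have "\<dots> = (residual_mat m r j *\<^sub>v v) $ i"
        using i v by (simp add: residual_mat_def scalar_prod_def mat_of_cols_index atLeast0LessThan)
      finally show "(residual_mat m r k *\<^sub>v ?u) $ i = (residual_mat m r j *\<^sub>v v) $ i" .
    qed (simp add: residual_mat_def)
    then have "?u = 0\<^sub>v k"
      using k 0 unfolding full_column_rank_iff_trivial_kernel[OF car] by auto
    then have "?u $ i = 0" if "i < j" for i
      using that \<open>j \<le> k\<close> by simp
    then show "v = 0\<^sub>v j" using v \<open>j \<le> k\<close> by (intro eq_vecI) auto
  qed
qed

text \<open>A trivial kernel makes the determinant nonzero, which rules out the unspecified value of
  \<open>mat_inv\<close>.\<close>

lemma mult_mat_inv: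
  assumes G: "G \<in> carrier_mat k k"
    and ker: "\<And>v. v \<in> carrier_vec k \<Longrightarrow> G *\<^sub>v v = 0\<^sub>v k \<Longrightarrow> v = 0\<^sub>v k"
  shows "mat_inv G \<in> carrier_mat k k" "G * mat_inv G = 1\<^sub>m k"
proof -
  have "det G \<noteq> 0" using det_0_iff_vec_prod_zero_field[OF G] ker by blast
  then have "mat_inverse G \<noteq> None"
    using det_non_zero_imp_unit[OF G] mat_inverse(1)[OF G] by metis
  then obtain B where "mat_inverse G = Some B" by blast
  then show "mat_inv G \<in> carrier_mat k k" "G * mat_inv G = 1\<^sub>m k"
    using mat_inverse(2)[OF G] by (auto simp: mat_inv_def)
qed

section \<open>One projection step and its Galerkin condition\<close>

lemma projection_step:
  assumes A: "A \<in> carrier_mat m n" and Z: "Z \<in> carrier_mat n k"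
    and SAZ: "S = A * Z" and rank: "full_column_rank S" and q: "q \<in> carrier_vec m"
    and p: "p = (transpose_mat A * S * mat_inv (transpose_mat S * A * transpose_mat A * S)
      * transpose_mat S) *\<^sub>v q"
  obtains w where "w \<in> carrier_vec k" "p = transpose_mat A *\<^sub>v (S *\<^sub>v w)"
    "transpose_mat S *\<^sub>v (A *\<^sub>v p) = transpose_mat S *\<^sub>v q"
proof -
  have S: "S \<in> carrier_mat m k" using A Z SAZ by simp
  let ?At = "transpose_mat A" and ?St = "transpose_mat S"
  have At: "?At \<in> carrier_mat n m" and St: "?St \<in> carrier_mat k m" using A S by auto
  define G where "G = ?St * A * ?At * S"
  have G: "G \<in> carrier_mat k k" using S by (intro carrier_matI) (simp_all add: G_def)
  have Gv: "G *\<^sub>v v = ?St *\<^sub>v (A *\<^sub>v (?At *\<^sub>v (S *\<^sub>v v)))" if v: "v \<in> carrier_vec k" for v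
  proof -
    have "G *\<^sub>v v = (?St * A * ?At) *\<^sub>v (S *\<^sub>v v)"
      unfolding G_def using A S v by (intro assoc_mult_mat_vec) auto
    also have "\<dots> = (?St * A) *\<^sub>v (?At *\<^sub>v (S *\<^sub>v v))"
      using A S v by (intro assoc_mult_mat_vec) auto
    also have "\<dots> = ?St *\<^sub>v (A *\<^sub>v (?At *\<^sub>v (S *\<^sub>v v)))"
      using A S v by (intro assoc_mult_mat_vec) auto
    finally show ?thesis .
  qed
  \<comment> \<open>The Gram form \<open>v \<bullet> (G *\<^sub>v v)\<close> is the squared length
    of \<open>?At *\<^sub>v (S *\<^sub>v v)\<close>, so \<open>S *\<^sub>v v\<close> lies in the
    kernel of the transpose of \<open>A\<close>. By \<open>S = A * Z\<close> it also lies in the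
    range of \<open>A\<close>. These two spaces are orthogonal, so \<open>S *\<^sub>v v\<close>
    vanishes and full column rank gives \<open>v = 0\<close>.\<close>
  have ker: "v = 0\<^sub>v k" if v: "v \<in> carrier_vec k" and 0: "G *\<^sub>v v = 0\<^sub>v k" for v
  proof -
    have Sv: "S *\<^sub>v v \<in> carrier_vec m" using S v by auto
    then have ASv: "?At *\<^sub>v (S *\<^sub>v v) \<in> carrier_vec n" using At by auto
    have Zv: "Z *\<^sub>v v \<in> carrier_vec n" using Z v by auto
    have "(?At *\<^sub>v (S *\<^sub>v v)) \<bullet> (?At *\<^sub>v (S *\<^sub>v v)) = (S *\<^sub>v v) \<bullet> (A *\<^sub>v (?At *\<^sub>v (S *\<^sub>v v)))"
      by (rule transpose_vec_mult_scalar[OF A ASv Sv])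
    also have "\<dots> = v \<bullet> (G *\<^sub>v v)"
      using Gv[OF v] transpose_vec_mult_scalar[OF St _ v, of "A *\<^sub>v (?At *\<^sub>v (S *\<^sub>v v))"] A ASv by simp
    also have "\<dots> = 0" using 0 v by simp
    finally have "?At *\<^sub>v (S *\<^sub>v v) = 0\<^sub>v n" using scalar_prod_self_eq_0[OF ASv] by simp
    then have "0 = (?At *\<^sub>v (S *\<^sub>v v)) \<bullet> (Z *\<^sub>v v)" using Zv by simp
    also have "\<dots> = (S *\<^sub>v v) \<bullet> (A *\<^sub>v (Z *\<^sub>v v))"
      by (rule transpose_vec_mult_scalar[OF A Zv Sv])
    also have "\<dots> = (S *\<^sub>v v) \<bullet> (S *\<^sub>v v)" using A Z v by (simp add: SAZ)
    finally have "S *\<^sub>v v = 0\<^sub>v m" using scalar_prod_self_eq_0[OF Sv] by simp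
    then show ?thesis
      using rank v unfolding full_column_rank_iff_trivial_kernel[OF S] by blast
  qed
  note inv = mult_mat_inv[OF G ker]
  define w where "w = mat_inv G *\<^sub>v (?St *\<^sub>v q)"
  have w: "w \<in> carrier_vec k" using inv(1) St q by (auto simp: w_def)
  have "p = (?At * S * mat_inv G) *\<^sub>v (?St *\<^sub>v q)"
    unfolding p G_def[symmetric] using At S inv(1) q by (intro assoc_mult_mat_vec) auto
  also have "\<dots> = (?At * S) *\<^sub>v w"
    unfolding w_def using At S inv(1) q by (intro assoc_mult_mat_vec) auto
  also have "\<dots> = ?At *\<^sub>v (S *\<^sub>v w)"
    using At S w by (intro assoc_mult_mat_vec) auto
  finally have pw: "p = ?At *\<^sub>v (S *\<^sub>v w)" .
  have "?St *\<^sub>v (A *\<^sub>v p) = G *\<^sub>v w" using Gv[OF w] pw by simp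
  also have "\<dots> = (G * mat_inv G) *\<^sub>v (?St *\<^sub>v q)"
    unfolding w_def using G inv(1) St q by (intro assoc_mult_mat_vec[symmetric]) auto
  also have "\<dots> = ?St *\<^sub>v q" using inv(2) St q by simp
  finally show thesis using that w pw by blast
qed

section \<open>The two-term recursion for an abstract orthogonal system\<close>

text \<open>Since \<open>P i\<close> lies in the span of \<open>Y 0, \<dots>, Y i\<close> with a nonzero coefficient at \<open>Y i\<close>, a vector
  orthogonal to all \<open>P i\<close> is orthogonal to all \<open>Y i\<close>. The defect of the expansion of \<open>Y (Suc K)\<close>
  in the orthogonal system \<open>P\<close> is such a vector, hence orthogonal to itself.\<close>

lemma orthogonal_two_term_recursion:
  fixes Y P :: "nat \<Rightarrow> real vec" and \<rho> :: "nat \<Rightarrow> real"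
  assumes Y: "\<And>i. i \<le> Suc K \<Longrightarrow> Y i \<in> carrier_vec n"
    and P: "\<And>i. i \<le> Suc K \<Longrightarrow> P i \<in> carrier_vec n"
    and \<rho>: "\<And>i. i \<le> Suc K \<Longrightarrow> \<rho> i \<noteq> 0"
    and span: "\<And>i. i \<le> Suc K \<Longrightarrow> \<exists>c. \<forall>v\<in>carrier_vec n. P i \<bullet> v = (\<Sum>l\<le>i. c l * (Y l \<bullet> v))"
    and diag: "\<And>i. i \<le> Suc K \<Longrightarrow> Y i \<bullet> P i = \<rho> i"
    and lower: "\<And>i l. i \<le> Suc K \<Longrightarrow> l < i \<Longrightarrow> Y l \<bullet> P i = 0"
    and last: "Y (Suc K) \<bullet> P K = - \<rho> (Suc K)"
    and last0: "\<And>l. l < K \<Longrightarrow> Y (Suc K) \<bullet> P l = 0"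
  defines "s \<equiv> \<rho> (Suc K)" and "a \<equiv> P (Suc K) \<bullet> P (Suc K)" and "b \<equiv> P K \<bullet> P K"
  shows "a > 0" "b > 0" "Y (Suc K) \<bullet> Y (Suc K) = s\<^sup>2 / a + s\<^sup>2 / b"
    "P (Suc K) = (a / b) \<cdot>\<^sub>v P K + (a / s) \<cdot>\<^sub>v Y (Suc K)"
proof -
  have pos: "P i \<bullet> P i > 0" if i: "i \<le> Suc K" for i
  proof -
    have "P i \<noteq> 0\<^sub>v n" using diag[OF i] \<rho>[OF i] Y[OF i] by auto
    then have "P i \<bullet> P i \<noteq> 0" using scalar_prod_self_eq_0[OF P[OF i]] by simp
    moreover have "P i \<bullet> P i \<ge> 0" by (simp add: scalar_prod_def sum_nonneg)
    ultimately show ?thesis by simp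
  qed
  show ab: "a > 0" "b > 0" using pos by (auto simp: a_def b_def)
  have s: "s \<noteq> 0" using \<rho> by (simp add: s_def)
  have orth: "P i \<bullet> P j = 0" if ij: "i < j" "j \<le> Suc K" for i j
  proof -
    obtain c where "P i \<bullet> P j = (\<Sum>l\<le>i. c l * (Y l \<bullet> P j))"
      using span[of i] P[of j] ij by (meson less_imp_le_nat order_trans)
    also have "\<dots> = 0" using lower[of j] ij by (intro sum.neutral) auto
    finally show ?thesis .
  qed
  note car = Y[of "Suc K"] P[of "Suc K"] P[of K]
  \<comment> \<open>The subtracted coefficients are the Fourier coefficients of
    \<open>Y (Suc K)\<close>: \<open>s / a\<close> along \<open>P (Suc K)\<close> by
    \<open>diag\<close>, and \<open>- s / b\<close> along \<open>P K\<close> by \<open>last\<close>;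
    by \<open>last0\<close> there are no others.\<close>
  define d where "d = Y (Suc K) + ((- s / a) \<cdot>\<^sub>v P (Suc K) + (s / b) \<cdot>\<^sub>v P K)"
  have d: "d \<in> carrier_vec n" using car by (simp add: d_def)
  have d_prod: "v \<bullet> d = v \<bullet> Y (Suc K) + ((- s / a) * (v \<bullet> P (Suc K)) + (s / b) * (v \<bullet> P K))"
    if "v \<in> carrier_vec n" for v
    using that car by (simp add: d_def scalar_prod_add_distrib[of _ n])
  have Pd: "P j \<bullet> d = 0" if j: "j \<le> Suc K" for j
  proof -
    have e: "P j \<bullet> Y (Suc K) = Y (Suc K) \<bullet> P j" "P j \<bullet> P K = P K \<bullet> P j"
      using comm_scalar_prod P[OF j] car by auto
    consider "j = Suc K" | "j = K" | "j < K" using j by linarith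
    then show ?thesis
    proof cases
      case 1
      then show ?thesis
        using d_prod[OF P[OF j]] e diag[of "Suc K"] orth[of K "Suc K"] ab
        by (simp add: a_def[symmetric] s_def[symmetric])
    next
      case 2
      then show ?thesis
        using d_prod[OF P[OF j]] e last orth[of K "Suc K"] ab
        by (simp add: b_def[symmetric] s_def[symmetric])
    next
      case 3
      then show ?thesis
        using d_prod[OF P[OF j]] e last0[OF 3] orth[of j "Suc K"] orth[of j K] by simp
    qed
  qed
  have Yd: "j \<le> Suc K \<Longrightarrow> Y j \<bullet> d = 0" for j
  proof (induction j rule: less_induct)
    case (less j)
    obtain c where c: "\<forall>v\<in>carrier_vec n. P j \<bullet> v = (\<Sum>l\<le>j. c l * (Y l \<bullet> v))"
      using span[OF less.prems] by blast
    \<comment> \<open>Used twice: \<open>v = P j\<close> shows \<open>c j \<noteq> 0\<close>, since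
      \<open>P j\<close> is nonzero; then \<open>v = d\<close> transfers orthogonality from
      \<open>P j\<close> to \<open>Y j\<close>.\<close>
    have split: "P j \<bullet> v = c j * (Y j \<bullet> v)"
      if "v \<in> carrier_vec n" "\<And>l. l < j \<Longrightarrow> Y l \<bullet> v = 0" for v
      using c that by (simp add: atMost_Suc_eq_insert_0 lessThan_Suc_atMost[symmetric])
    have "P j \<bullet> P j = c j * (Y j \<bullet> P j)"
      using lower[OF less.prems] P[OF less.prems] by (intro split) auto
    then have "c j \<noteq> 0" using pos[OF less.prems] by auto
    moreover have "P j \<bullet> d = c j * (Y j \<bullet> d)"
      using less d by (intro split) auto
    ultimately show ?case using Pd[OF less.prems] by simp
  qed
  have "d \<bullet> d = d \<bullet> Y (Suc K) + ((- s / a) * (d \<bullet> P (Suc K)) + (s / b) * (d \<bullet> P K))"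
    by (rule d_prod[OF d])
  also have "\<dots> = 0"
    using Yd[of "Suc K"] Pd[of "Suc K"] Pd[of K] comm_scalar_prod[OF d] car by simp
  finally have d0: "d = 0\<^sub>v n" using scalar_prod_self_eq_0[OF d] by simp
  show "P (Suc K) = (a / b) \<cdot>\<^sub>v P K + (a / s) \<cdot>\<^sub>v Y (Suc K)"
  proof (rule eq_vecI)
    fix i assume "i < dim_vec ((a / b) \<cdot>\<^sub>v P K + (a / s) \<cdot>\<^sub>v Y (Suc K))"
    then have i: "i < n" using car by simp
    have "d $ i = 0" using d0 i by simp
    then show "P (Suc K) $ i = ((a / b) \<cdot>\<^sub>v P K + (a / s) \<cdot>\<^sub>v Y (Suc K)) $ i"
      using i car ab s by (simp add: d_def field_simps)
  qed (use car in simp)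
  \<comment> \<open>Pythagoras for the expansion, read off from
    \<open>Y (Suc K) \<bullet> d = 0\<close>.\<close>
  show "Y (Suc K) \<bullet> Y (Suc K) = s\<^sup>2 / a + s\<^sup>2 / b"
    using d_prod[OF car(1)] Yd[of "Suc K"] diag[of "Suc K"] last
    by (simp add: s_def[symmetric] power2_eq_square)
qed

section \<open>Residual orthogonality and the recursion for the updates\<close>

theorem theorem4p1:
  fixes A :: "real mat" and m n :: nat and b :: "real vec"
    and x r p y :: "nat \<Rightarrow> real vec" and S :: "nat \<Rightarrow> real mat" and \<beta> \<gamma> :: "nat \<Rightarrow> real"
  assumes A: "A \<in> carrier_mat m n"
    and b: "b \<in> (\<lambda>z. A *\<^sub>v z) ` carrier_vec n"
    and x0: "x 0 \<in> carrier_vec n"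
    and r: "\<And>k. r k = b - A *\<^sub>v x k"
    and S: "\<And>k. S k = residual_mat m r k"
    and p: "\<And>k. k \<ge> 1 \<Longrightarrow> full_column_rank (S k) \<Longrightarrow>
      p k = (transpose_mat A * S k
              * mat_inv (transpose_mat (S k) * A * transpose_mat A * S k)
              * transpose_mat (S k)) *\<^sub>v r (k - 1)"
    and x: "\<And>k. k \<ge> 1 \<Longrightarrow> full_column_rank (S k) \<Longrightarrow> x k = x (k - 1) + p k"
    and y: "\<And>k. k \<ge> 1 \<Longrightarrow> y k = transpose_mat A *\<^sub>v r (k - 1)"
    and \<beta>: "\<And>k. k \<ge> 2 \<Longrightarrow> \<beta> (k - 1) =
      1 / ((vnorm (p (k - 1)) * vnorm (y k) / (vnorm (r (k - 1)) * vnorm (r (k - 1))) - 1)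
         * (vnorm (p (k - 1)) * vnorm (y k) / (vnorm (r (k - 1)) * vnorm (r (k - 1))) + 1))"
    and \<gamma>: "\<And>k. k \<ge> 2 \<Longrightarrow> \<gamma> (k - 1) =
      (vnorm (r (k - 1)))\<^sup>2 /
        ((vnorm (y k))\<^sup>2
         * (1 - vnorm (r (k - 1)) * vnorm (r (k - 1)) / (vnorm (p (k - 1)) * vnorm (y k)))
         * (1 + vnorm (r (k - 1)) * vnorm (r (k - 1)) / (vnorm (p (k - 1)) * vnorm (y k))))"
  shows "\<forall>k \<ge> 2. full_column_rank (S k) \<longrightarrow>
    vnorm (r (k - 1)) \<noteq> 0 \<and> vnorm (p (k - 1)) \<noteq> 0 \<and> vnorm (y k) \<noteq> 0 \<and>
    vnorm (p (k - 1)) * vnorm (y k) / (vnorm (r (k - 1)) * vnorm (r (k - 1))) \<noteq> 1 \<and>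
    p k = \<beta> (k - 1) \<cdot>\<^sub>v p (k - 1) + \<gamma> (k - 1) \<cdot>\<^sub>v y k"
proof (intro allI impI)
  fix k :: nat assume k2: "k \<ge> 2" and fk: "full_column_rank (S k)"
  obtain z where z: "z \<in> carrier_vec n" and bz: "b = A *\<^sub>v z" using b by blast
  have Sc: "S j \<in> carrier_mat m j" for j
    by (simp add: S residual_mat_def carrier_matI)
  have full: "full_column_rank (S j)" if "j \<le> k" for j
    using fk that full_column_rank_residual_mat_mono by (simp add: S)
  have At: "transpose_mat A \<in> carrier_mat n m" using A by simp
  have rc: "r i \<in> carrier_vec m" if "x i \<in> carrier_vec n" for i
    using A that z by (simp add: r bz)
  have col: "col (S j) i = r i" if "i < j" "x i \<in> carrier_vec n" for i j
    using rc[OF that(2)] that(1) by (simp add: S residual_mat_def)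
  \<comment> \<open>As \<open>b = A *\<^sub>v z\<close>, each residual is the image under
    \<open>A\<close> of the error \<open>z - x i\<close>; the errors are the columns of the factor
    \<open>?Z\<close>. Only iterates before \<open>j\<close> are assumed to have the right
    dimension, because the induction for \<open>xc\<close> rests on this claim.\<close>
  have step: "\<exists>w\<in>carrier_vec j. p j = transpose_mat A *\<^sub>v (S j *\<^sub>v w) \<and>
      transpose_mat (S j) *\<^sub>v (A *\<^sub>v p j) = transpose_mat (S j) *\<^sub>v r (j - 1)"
    if j: "1 \<le> j" "j \<le> k" and xs: "\<And>i. i < j \<Longrightarrow> x i \<in> carrier_vec n" for j
  proof -
    let ?Z = "mat_of_cols n (map (\<lambda>i. z - x i) [0..<j])"
    have Z: "?Z \<in> carrier_mat n j" by (simp add: carrier_matI)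
    have "S j = A * ?Z"
    proof (rule mat_col_eqI)
      fix i assume "i < dim_col (A * ?Z)"
      then have i: "i < j" by simp
      then have "col (A * ?Z) i = A *\<^sub>v col ?Z i"
        using A Z by (intro col_mult2) auto
      also have "\<dots> = A *\<^sub>v (z - x i)"
        using i xs[OF i] z by simp
      also have "\<dots> = r i"
        using mult_minus_distrib_mat_vec[OF A z xs[OF i]] by (simp add: r bz)
      finally show "col (S j) i = col (A * ?Z) i" using col[OF i xs[OF i]] by simp
    qed (use A Sc[of j] in auto)
    from projection_step[OF A Z this full[OF j(2)] rc[OF xs] p[OF j(1) full[OF j(2)]]] j(1)
    show ?thesis by (metis One_nat_def Suc_pred diff_Suc_less less_eq_Suc_le)
  qed
  have xc: "j \<le> k \<Longrightarrow> x j \<in> carrier_vec n" for j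
  proof (induction j rule: less_induct)
    case (less j)
    show ?case
    proof (cases "j = 0")
      case True
      then show ?thesis using x0 by simp
    next
      case False
      then have j: "1 \<le> j" "j \<le> k" using less.prems by auto
      obtain w where "w \<in> carrier_vec j" "p j = transpose_mat A *\<^sub>v (S j *\<^sub>v w)"
        using step[OF j] less by fastforce
      then have "p j \<in> carrier_vec n" using At Sc[of j] by simp
      moreover have "x (j - 1) \<in> carrier_vec n" using less j by simp
      ultimately show ?thesis using x[OF j(1) full[OF j(2)]] by simp
    qed
  qed
  have rc: "r j \<in> carrier_vec m" if "j \<le> k" for j using rc[OF xc[OF that]] .
  have col: "col (S j) i = r i" if "i < j" "j \<le> k" for i j using col xc that by simp
  have w_ex: "\<exists>w\<in>carrier_vec j. p j = transpose_mat A *\<^sub>v (S j *\<^sub>v w)"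
    if "1 \<le> j" "j \<le> k" for j
    using step[OF that] xc that by fastforce
  have pc: "p j \<in> carrier_vec n" if "1 \<le> j" "j \<le> k" for j
    using w_ex[OF that] At Sc[of j] by auto
  \<comment> \<open>Entry \<open>i\<close> of the projected equation, column \<open>i\<close> of
    \<open>S j\<close> being \<open>r i\<close>.\<close>
  have Galerkin: "r i \<bullet> (A *\<^sub>v p j) = r i \<bullet> r (j - 1)" if "i < j" "j \<le> k" for i j
  proof -
    have "transpose_mat (S j) *\<^sub>v (A *\<^sub>v p j) = transpose_mat (S j) *\<^sub>v r (j - 1)"
      using step[of j] xc that by fastforce
    then have "(transpose_mat (S j) *\<^sub>v (A *\<^sub>v p j)) $ i = (transpose_mat (S j) *\<^sub>v r (j - 1)) $ i"
      by simp
    then show ?thesis using Sc[of j] that col[OF that] by simp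
  qed
  have Ap: "A *\<^sub>v p j = r (j - 1) - r j" if j: "1 \<le> j" "j \<le> k" for j
  proof -
    have xj: "x j = x (j - 1) + p j" using x[OF j(1) full[OF j(2)]] .
    have "A *\<^sub>v x j = A *\<^sub>v x (j - 1) + A *\<^sub>v p j"
      unfolding xj using A xc[of "j - 1"] pc[OF j] j by (intro mult_add_distrib_mat_vec) auto
    moreover have "A *\<^sub>v x (j - 1) \<in> carrier_vec m" "A *\<^sub>v p j \<in> carrier_vec m" "b \<in> carrier_vec m"
      using A xc[of "j - 1"] pc[OF j] j z bz by auto
    ultimately show ?thesis by (intro eq_vecI) (auto simp: r)
  qed
  \<comment> \<open>The Galerkin condition says that \<open>A\<close> applied to \<open>p j\<close>,
    which is the drop from \<open>r (j - 1)\<close> to \<open>r j\<close>, has the same product with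
    \<open>r i\<close> as \<open>r (j - 1)\<close>; nothing is left for \<open>r j\<close>.\<close>
  have orth: "r i \<bullet> r j = 0" if ij: "i < j" "j \<le> k" for i j
  proof -
    have "r i \<bullet> r (j - 1) = r i \<bullet> (r (j - 1) - r j)"
      using Galerkin[OF ij] Ap[of j] ij by simp
    also have "\<dots> = r i \<bullet> r (j - 1) - r i \<bullet> r j"
      using rc ij by (intro scalar_prod_minus_distrib) auto
    finally show ?thesis by simp
  qed
  \<comment> \<open>A zero residual would be a zero column of \<open>S k\<close>. This stops at
    \<open>k - 1\<close>: \<open>r k\<close> is not a column and may vanish.\<close>
  have r_nz: "r i \<bullet> r i \<noteq> 0" if i: "i < k" for i
  proof
    assume "r i \<bullet> r i = 0"
    then have "r i = 0\<^sub>v m" using scalar_prod_self_eq_0[OF rc[of i]] i by simp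
    then have "S k *\<^sub>v unit_vec k i = 0\<^sub>v m"
      using mat_mult_unit_vec[OF Sc[of k] i] col[OF i] by simp
    then have "unit_vec k i = (0\<^sub>v k :: real vec)"
      using fk unfolding full_column_rank_iff_trivial_kernel[OF Sc] by auto
    then have "unit_vec k i $ i = (0 :: real)" using i by simp
    then show False using i by simp
  qed
  \<comment> \<open>Shift to indices from 0: \<open>Y i\<close> and \<open>p (Suc i)\<close> belong
    to step \<open>i + 1\<close>, so \<open>Suc K\<close> stands for step \<open>k\<close> and
    \<open>K\<close> for step \<open>k - 1\<close>.\<close>
  define K where "K = k - 2"
  have k: "k = Suc (Suc K)" using k2 by (simp add: K_def)
  define Y where "Y i = transpose_mat A *\<^sub>v r i" for i
  have Yc: "Y i \<in> carrier_vec n" if "i \<le> k" for i using At rc[OF that] by (simp add: Y_def)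
  have Yv: "Y i \<bullet> v = r i \<bullet> (A *\<^sub>v v)" if "i \<le> k" "v \<in> carrier_vec n" for i v
    unfolding Y_def by (rule transpose_vec_mult_scalar[OF A that(2) rc[OF that(1)]])
  \<comment> \<open>The coefficients are the entries of the vector \<open>w\<close> produced by the
    projection step.\<close>
  have span: "\<exists>c. \<forall>v\<in>carrier_vec n. p (Suc i) \<bullet> v = (\<Sum>l\<le>i. c l * (Y l \<bullet> v))"
    if i: "i \<le> Suc K" for i
  proof -
    obtain w where w: "w \<in> carrier_vec (Suc i)"
      and pw: "p (Suc i) = transpose_mat A *\<^sub>v (S (Suc i) *\<^sub>v w)"
      using w_ex[of "Suc i"] i k by auto
    have "p (Suc i) \<bullet> v = (\<Sum>l\<le>i. w $ l * (Y l \<bullet> v))" if v: "v \<in> carrier_vec n" for v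
    proof -
      have Av: "A *\<^sub>v v \<in> carrier_vec m" using A v by simp
      have "p (Suc i) \<bullet> v = (S (Suc i) *\<^sub>v w) \<bullet> (A *\<^sub>v v)"
        unfolding pw by (rule transpose_vec_mult_scalar[OF A v mult_mat_vec_carrier[OF Sc w]])
      also have "\<dots> = w \<bullet> (transpose_mat (S (Suc i)) *\<^sub>v (A *\<^sub>v v))"
        using transpose_vec_mult_scalar[of "transpose_mat (S (Suc i))" "Suc i" m "A *\<^sub>v v" w]
          Sc[of "Suc i"] w Av by simp
      also have "\<dots> = (\<Sum>l\<le>i. w $ l * (col (S (Suc i)) l \<bullet> (A *\<^sub>v v)))"
        using Sc[of "Suc i"] by (simp add: scalar_prod_def[of w] atLeast0LessThan lessThan_Suc_atMost)
      also have "\<dots> = (\<Sum>l\<le>i. w $ l * (Y l \<bullet> v))"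
        using col[of _ "Suc i"] Yv[OF _ v] i k by (intro sum.cong) auto
      finally show ?thesis .
    qed
    then show ?thesis by blast
  qed
  let ?P = "\<lambda>i. p (Suc i)"
  have YP: "Y l \<bullet> ?P i = r l \<bullet> r i" if "l \<le> i" "i \<le> Suc K" for i l
    using Yv[of l "?P i"] Galerkin[of l "Suc i"] pc[of "Suc i"] that k by simp
  \<comment> \<open>Both products on the right vanish for \<open>l < K\<close>; for
    \<open>l = K\<close> the second one survives and gives the minus sign in
    \<open>last\<close>.\<close>
  have YlP: "Y (Suc K) \<bullet> ?P l = r (Suc K) \<bullet> r l - r (Suc K) \<bullet> r (Suc l)" if "l \<le> K" for l
    using Yv[of "Suc K" "?P l"] Ap[of "Suc l"] pc[of "Suc l"] that k
      scalar_prod_minus_distrib[OF rc rc rc, of "Suc K" l "Suc l"] by simp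
  have r_comm: "r (Suc K) \<bullet> r l = r l \<bullet> r (Suc K)" if "l \<le> Suc K" for l
    using comm_scalar_prod[OF rc rc, of "Suc K" l] k that by simp
  define s where "s = r (Suc K) \<bullet> r (Suc K)"
  define a' where "a' = p (Suc (Suc K)) \<bullet> p (Suc (Suc K))"
  define b' where "b' = p (Suc K) \<bullet> p (Suc K)"
  have Yc': "Y i \<in> carrier_vec n" and Pc': "?P i \<in> carrier_vec n" and nz': "r i \<bullet> r i \<noteq> 0"
    if "i \<le> Suc K" for i
    using that Yc[of i] pc[of "Suc i"] r_nz[of i] k by auto
  have diag: "Y i \<bullet> ?P i = r i \<bullet> r i" if "i \<le> Suc K" for i
    using YP[of i i] that by simp
  have lower: "Y l \<bullet> ?P i = 0" if "i \<le> Suc K" "l < i" for i l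
    using YP[of l i] orth[of l i] that k by simp
  have last: "Y (Suc K) \<bullet> ?P K = - (r (Suc K) \<bullet> r (Suc K))"
    using YlP[of K] r_comm[of K] orth[of K "Suc K"] k by simp
  have last0: "Y (Suc K) \<bullet> ?P l = 0" if "l < K" for l
    using YlP[of l] r_comm[of l] r_comm[of "Suc l"] orth[of l "Suc K"] orth[of "Suc l" "Suc K"] that k
    by simp
  note rec = orthogonal_two_term_recursion[of K Y n ?P "\<lambda>i. r i \<bullet> r i",
      OF Yc' Pc' nz' span diag lower last last0, folded s_def a'_def b'_def]
  have s: "s > 0" using r_nz[of "Suc K"] k
    by (metis lessI less_eq_real_def s_def vnorm_square zero_le_square)
  have yk: "y k = Y (Suc K)" using y[of k] k by (simp add: Y_def)
  define N where "N = vnorm (p (k - 1))"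
  define M where "M = vnorm (y k)"
  define R where "R = vnorm (r (k - 1))"
  have RR: "R * R = s" by (simp add: R_def vnorm_square s_def k)
  have NN: "N * N = b'" by (simp add: N_def vnorm_square b'_def k)
  have MM: "M * M = s\<^sup>2 / a' + s\<^sup>2 / b'" using rec(3) by (simp add: M_def vnorm_square yk)
  have NM: "N * M * (N * M) = s\<^sup>2 * (b' / a' + 1)"
  proof -
    have "N * M * (N * M) = (N * N) * (M * M)" by simp
    also have "\<dots> = s\<^sup>2 * (b' / a' + 1)" unfolding NN MM using rec(1,2) by (simp add: field_simps)
    finally show ?thesis .
  qed
  have nz: "R \<noteq> 0" "N \<noteq> 0" using RR NN s rec(2) by auto
  have "s\<^sup>2 / a' + s\<^sup>2 / b' > 0" using rec(1,2) s by (intro add_pos_pos) auto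
  then have nzM: "M \<noteq> 0" using MM by auto
  \<comment> \<open>The denominator of \<beta> is a difference of squares, evaluated by
    \<open>NM\<close>.\<close>
  have X: "(N * M / s - 1) * (N * M / s + 1) = b' / a'"
  proof -
    have "(N * M / s - 1) * (N * M / s + 1) = N * M * (N * M) / s\<^sup>2 - 1"
      by (simp add: algebra_simps power2_eq_square)
    then show ?thesis unfolding NM using s by simp
  qed
  \<comment> \<open>In the denominator of \<gamma> the difference of squares removes exactly the
    \<open>p (k - 1)\<close> part of \<open>M * M\<close>.\<close>
  have W: "M\<^sup>2 * (1 - s / (N * M)) * (1 + s / (N * M)) = s\<^sup>2 / a'"
  proof -
    have "M\<^sup>2 * (1 - s / (N * M)) * (1 + s / (N * M)) = M * M - s\<^sup>2 / (N * N)"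
      using nz nzM by (simp add: field_simps power2_eq_square)
    then show ?thesis unfolding NN MM by simp
  qed
  \<comment> \<open>The value 1 would make the left side of \<open>X\<close> zero, whereas
    \<open>b' / a'\<close> is positive; so \<beta> is not the result of a division by zero.\<close>
  have ne1: "N * M / s \<noteq> 1" using X rec(1,2) by auto
  have bk: "\<beta> (k - 1) = a' / b'"
    using \<beta>[OF k2, folded N_def M_def R_def, unfolded RR X] by simp
  have gk: "\<gamma> (k - 1) = a' / s"
    using \<gamma>[OF k2, folded N_def M_def R_def, unfolded RR W] RR s
    by (simp add: power2_eq_square)
  have "p k = \<beta> (k - 1) \<cdot>\<^sub>v p (k - 1) + \<gamma> (k - 1) \<cdot>\<^sub>v y k"
    using rec(4) unfolding bk gk yk by (simp add: k)
  then show "vnorm (r (k - 1)) \<noteq> 0 \<and> vnorm (p (k - 1)) \<noteq> 0 \<and> vnorm (y k) \<noteq> 0 \<and>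
      vnorm (p (k - 1)) * vnorm (y k) / (vnorm (r (k - 1)) * vnorm (r (k - 1))) \<noteq> 1 \<and>
      p k = \<beta> (k - 1) \<cdot>\<^sub>v p (k - 1) + \<gamma> (k - 1) \<cdot>\<^sub>v y k"
    using nz nzM ne1 unfolding N_def[symmetric] M_def[symmetric] R_def[symmetric] RR by blast
qed

end
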